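(* Let $q$ be an odd prime power and $n\ge2$ with $(q^n-1)/2$ even, let $\beta\in\mathbb{F}_q^*$ and $Q=(q^n-1)/(q-1)$. Write the product of the distinct prime divisors of $q^n-1$ as $k\,p_1\cdots p_s$, where $s\ge0$ and $p_1,\dots,p_s$ are distinct primes not dividing $k$, ordered so that $p_i\mid Q$ for $1\le i\le r$ and $p_i\nmid Q$ for $r<i\le s$. Let $\delta=1-\sum_{i=1}^s 1/p_i$ (with $\delta=1$ if $s=0$), $\delta_Q=1-\sum_{i=1}^r1/p_i$, and let $k_Q$ be the product of the primes dividing $k$ that divide $Q$. Assume $\delta>0$. Then $$\mathcal{N}_\beta(q^n-1)\ \ge\ \delta\,\theta(k)\,q^{\frac{n-1}{2}}\Big\{q^{\frac{n-1}{2}}-4\Big(\frac{s-1}{\delta}+2\Big)W(k)+2\Big(\frac{r-1+\delta_Q}{\delta}+1\Big)W(k_Q)\Big\}.$$ Hence, if $q^{\frac{n-1}{2}}>4\big(\frac{s-1}{\delta}+2\big)W(k)-2\big(\frac{r-1+\delta_Q}{\delta}+1\big)W(k_Q)$, then $\mathcal{N}_\beta(q^n-1)>0$.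
   Context: For a divisor $m$ of $q^n-1$, an element $\xi\in\mathbb{F}_{q^n}^*$ is $m$-free if $\xi=\zeta^d$ with $d\mid m$ and $\zeta\in\mathbb{F}_{q^n}^*$ implies $d=1$. $\mathcal{N}_\beta(m)$ is the number of $m$-free $\xi\in\mathbb{F}_{q^n}^*$ with $\mathrm{Tr}(\xi^2)=\beta$, where $\mathrm{Tr}(\xi)=\sum_{i=0}^{n-1}\xi^{q^i}$. $\theta(k)=\phi(k)/k$ and $W(t)$ is the number of square-free divisors of $t$. *)

theory Defs
  imports Complex_Main "HOL-Library.Cardinality" "HOL-Number_Theory.Number_Theory"
    "HOL-Number_Theory.Prime_Powers" "HOL-Computational_Algebra.Squarefree"
begin

text \<open>
  The field with \<open>q ^ n\<close> elements is a type \<open>'a\<close> of sort \<open>{field, finite}\<close> with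
  \<open>CARD('a) = q ^ n\<close>; the field with \<open>q\<close> elements is its subfield of cardinality \<open>q\<close>.
\<close>

definition is_subfield :: "'a::field set \<Rightarrow> bool" where
  "is_subfield K \<longleftrightarrow> 0 \<in> K \<and> 1 \<in> K \<and>
     (\<forall>x\<in>K. \<forall>y\<in>K. x + y \<in> K \<and> x * y \<in> K) \<and>
     (\<forall>x\<in>K. - x \<in> K) \<and> (\<forall>x\<in>K. x \<noteq> 0 \<longrightarrow> inverse x \<in> K)"

definition m_free :: "nat \<Rightarrow> 'a::field \<Rightarrow> bool" where
  "m_free m \<xi> \<longleftrightarrow> \<xi> \<noteq> 0 \<and>
     (\<forall>d \<zeta>. d dvd m \<longrightarrow> \<zeta> \<noteq> 0 \<longrightarrow> \<xi> = \<zeta> ^ d \<longrightarrow> d = 1)"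

definition Tr :: "nat \<Rightarrow> nat \<Rightarrow> 'a::field \<Rightarrow> 'a" where
  "Tr q n \<xi> = (\<Sum>i<n. \<xi> ^ (q ^ i))"

definition N_free :: "nat \<Rightarrow> nat \<Rightarrow> 'a::{field,finite} \<Rightarrow> nat \<Rightarrow> nat" where
  "N_free q n \<beta> m = card {\<xi>. m_free m \<xi> \<and> Tr q n (\<xi>\<^sup>2) = \<beta>}"

definition \<theta> :: "nat \<Rightarrow> real" where
  "\<theta> k = real (totient k) / real k"

definition W :: "nat \<Rightarrow> nat" where
  "W t = card {d. d dvd t \<and> squarefree d}"

end

theory Submission
  imports Defs "HOL-Computational_Algebra.Polynomial"
begin

text \<open>
  For a multiplicative character \<open>\<omega>\<close> let \<open>U\<^sub>b(\<omega>)\<close> be the sum of \<open>\<omega>(y)\<close> over all \<open>y \<noteq> 0\<close> of trace \<open>b\<close>.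
  Substituting \<open>y \<mapsto> c y\<close> with \<open>c \<in> F\<^sub>q\<^sup>*\<close> shows that \<open>|U\<^sub>b(\<omega>)|\<close> is the same for all \<open>b \<in> F\<^sub>q\<^sup>*\<close>, and
  for \<open>\<omega> \<noteq> 1\<close> the sum of \<open>|U\<^sub>b(\<omega>)|\<^sup>2\<close> over \<open>b \<in> F\<^sub>q\<close> is \<open>q\<^bsup>n\<^esup> - q\<^bsup>n-1\<^esup>\<close>, because the trace is equidistributed.
  Hence \<open>|U\<^sub>b(\<omega>)| \<le> q\<^bsup>(n-1)/2\<^esup>\<close> without any use of Gauss sums. If \<open>\<eta> = \<omega>\<^sup>2\<close> and \<open>\<lambda>\<close> is the quadratic
  character, the sum of \<open>\<eta>(\<xi>)\<close> over \<open>Tr(\<xi>\<^sup>2) = b\<close> is \<open>U\<^sub>b(\<omega>) + U\<^sub>b(\<omega>\<lambda>)\<close>; if \<open>\<eta>\<close> is not a square, it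
  vanishes since \<open>\<eta>(-1) = -1\<close>. So every nontrivial character contributes at most \<open>2 q\<^bsup>(n-1)/2\<^esup>\<close>.
  Expanding the indicator of \<open>m\<close>-free elements into characters and applying the sieve
  \<open>N(k p\<^sub>1 \<dots> p\<^sub>s) \<ge> \<Sum>\<^sub>i N(k p\<^sub>i) - (s - 1) N(k)\<close> gives the bound with \<open>2 ((s - 1)/\<delta> + 2) W(k)\<close> as the
  subtracted term, which is at most the one claimed because \<open>r - 1 + \<delta>\<^sub>Q \<le> s - 1 + \<delta>\<close> and
  \<open>W(k\<^sub>Q) \<le> W(k)\<close>.
\<close>

section \<open>Characters and the trace of a finite field\<close>

text \<open>The type is repackaged as a record ring so that the HOL-Algebra theorem on the cyclic
  multiplicative group of a finite field applies.\<close>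

lemma ex_generator_finite_field: "\<exists>g::'a::{field,finite}. g \<noteq> 0 \<and> (\<forall>x. x \<noteq> 0 \<longrightarrow> (\<exists>i::nat. x = g ^ i))"
proof -
  define R where "R = \<lparr>carrier = (UNIV :: 'a set), monoid.mult = (*), one = 1 :: 'a, ring.zero = 0 :: 'a, add = (+)\<rparr>"
  have "\<exists>y. x + y = 0" for x :: 'a
    using add.right_inverse by blast
  moreover have "x \<noteq> 0 \<Longrightarrow> \<exists>y. x * y = 1" for x :: 'a
    by (rule exI[of _ "inverse x"]) auto
  ultimately interpret R: field R
    unfolding R_def using add.right_inverse by unfold_locales (auto simp: algebra_simps Units_def)
  have R: "carrier R = UNIV" "\<zero>\<^bsub>R\<^esub> = 0"
    by (auto simp: R_def)
  have pow: "a [^]\<^bsub>R\<^esub> i = a ^ i" for a :: 'a and i :: nat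
    by (induction i) (auto simp: R_def mult.commute)
  obtain g where "g \<in> carrier (mult_of R)" and g: "carrier (mult_of R) =
      {g [^]\<^bsub>R\<^esub> i | i::nat. i \<in> UNIV}"
    using R.finite_field_mult_group_has_gen[OF finite[of "carrier R"]] by (rule bexE) (rule that)
  hence "g \<noteq> 0"
    by (simp add: carrier_mult_of R)
  moreover have "\<exists>i::nat. x = g ^ i" if "x \<noteq> 0" for x
  proof -
    have "x \<in> carrier (mult_of R)"
      using that by (simp add: carrier_mult_of R)
    thus ?thesis
      unfolding g pow by blast
  qed
  ultimately show ?thesis
    by (intro exI[of _ g] conjI allI impI)
qed

text \<open>Multiplication by \<open>x \<noteq> 0\<close> permutes \<open>K - {0}\<close>; comparing
  the product of all its elements before and after gives
  \<open>x ^ (card K - 1) = 1\<close>.\<close>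

lemma subfield_power_card:
  fixes K :: "'a::{field,finite} set"
  assumes K: "is_subfield K" and x: "x \<in> K"
  shows "x ^ card K = x"
proof (cases "x = 0")
  case True
  have "card K > 0"
    using x by (auto simp: card_gt_0_iff)
  thus ?thesis
    using True by simp
next
  case False
  have inv: "inverse x \<in> K"
    using assms False by (auto simp: is_subfield_def)
  have mult: "u * v \<in> K" if "u \<in> K" "v \<in> K" for u v
    using K that by (auto simp: is_subfield_def)
  have bij: "bij_betw (\<lambda>y. x * y) (K - {0}) (K - {0})"
  proof (rule bij_betw_byWitness[where f' = "\<lambda>y. inverse x * y"])
    show "(\<lambda>y. x * y) ` (K - {0}) \<subseteq> K - {0}" "(\<lambda>y. inverse x * y) ` (K - {0}) \<subseteq> K - {0}"
      using mult[OF x] mult[OF inv] False by auto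
  qed (use False in auto)
  have "(\<Prod>y\<in>K - {0}. y) = (\<Prod>y\<in>K - {0}. x * y)"
    using prod.reindex_bij_betw[OF bij, of "\<lambda>y. y"] by simp
  also have "\<dots> = x ^ card (K - {0}) * (\<Prod>y\<in>K - {0}. y)"
    by (simp add: prod.distrib)
  finally have "x ^ card (K - {0}) = 1"
    by simp
  moreover have "card K = Suc (card (K - {0}))"
    using K by (intro card.remove) (auto simp: is_subfield_def)
  ultimately show ?thesis
    by simp
qed

lemma finite_field_power_card_minus_1:
  fixes x :: "'a::{field,finite}"
  assumes "x \<noteq> 0"
  shows "x ^ (CARD('a) - 1) = 1"
proof -
  have "is_subfield (UNIV :: 'a set)"
    by (simp add: is_subfield_def)
  hence "x ^ CARD('a) = x"
    using subfield_power_card[of UNIV x] by simp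
  moreover have "x ^ CARD('a) = x * x ^ (CARD('a) - 1)"
    by (subst power_eq_if) simp
  ultimately show ?thesis
    using assms by simp
qed

lemma power_eq_power_iff_mod:
  fixes a :: "'a::monoid_mult"
  assumes "a ^ m = 1" "m > 0" "inj_on ((^) a) {..<m}"
  shows "a ^ i = a ^ j \<longleftrightarrow> i mod m = j mod m"
proof -
  have red: "a ^ i = a ^ (i mod m)" for i
  proof -
    have "a ^ i = a ^ (m * (i div m) + i mod m)"
      by simp
    also have "\<dots> = a ^ (i mod m)"
      unfolding power_add power_mult assms by simp
    finally show ?thesis .
  qed
  show ?thesis
    using assms(2,3) by (subst red, subst (2) red) (auto simp: inj_on_def)
qed

text \<open>A generator of the unit group is sent to a primitive root of unity of the same order.
  Injectivity makes this a generator of the character group: its powers are all multiplicative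
  characters.\<close>

lemma ex_injective_character:
  "\<exists>\<chi>::'a::{field,finite} \<Rightarrow> complex. inj \<chi> \<and> \<chi> 0 = 0 \<and> (\<forall>x y. \<chi> (x * y) = \<chi> x * \<chi> y)"
proof -
  obtain g :: 'a where g: "g \<noteq> 0" "\<And>x. x \<noteq> 0 \<Longrightarrow> \<exists>i::nat. x = g ^ i"
    using ex_generator_finite_field by blast
  define N where "N = CARD('a) - 1"
  have card_N: "card (UNIV - {0::'a}) = N"
    by (simp add: N_def card_Diff_singleton)
  have "1 \<in> UNIV - {0::'a}"
    by simp
  hence "card (UNIV - {0::'a}) > 0"
    unfolding card_gt_0_iff using finite[of "UNIV - {0::'a}"] by blast
  hence N: "N > 0"
    by (simp only: card_N)
  have gN: "g ^ N = 1"
    using finite_field_power_card_minus_1 g by (simp add: N_def)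
  have "x \<in> (^) g ` {..<N}" if x: "x \<noteq> 0" for x
  proof -
    obtain i where "x = g ^ i"
      using g(2)[OF x] by blast
    also have "\<dots> = g ^ (N * (i div N) + i mod N)"
      by simp
    also have "\<dots> = g ^ (i mod N)"
      unfolding power_add power_mult gN by simp
    finally show ?thesis
      using N by auto
  qed
  hence "(^) g ` {..<N} = UNIV - {0}"
    using g(1) by auto
  hence "inj_on ((^) g) {..<N}"
    by (intro eq_card_imp_inj_on) (auto simp: card_N)
  note g_iff = power_eq_power_iff_mod[OF gN N this]
  define e where "e = cis (2 * pi / real N)"
  have e_pow: "e ^ i = cis (2 * pi * real i / real N)" for i
    by (simp add: e_def DeMoivre field_simps)
  have "inj_on ((^) e) {..<N}"
    using bij_betw_imp_inj_on[OF bij_betw_roots_unity[OF N]] by (simp add: inj_on_def e_pow)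
  moreover have eN: "e ^ N = 1"
    using N by (simp add: e_pow)
  ultimately have e_iff: "e ^ i = e ^ j \<longleftrightarrow> i mod N = j mod N" for i j
    using power_eq_power_iff_mod N by blast
  \<comment> \<open>An arbitrary discrete logarithm suffices, since powers of \<open>g\<close> and
    of \<open>e\<close> depend on the exponent modulo \<open>N\<close> in the same way.\<close>
  define l where "l x = (SOME i. x = g ^ i)" for x
  have l: "g ^ l x = x" if "x \<noteq> 0" for x
    unfolding l_def using someI_ex[OF g(2)[OF that]] by simp
  define \<chi> where "\<chi> x = (if x = 0 then 0 else e ^ l x)" for x
  have e0: "e \<noteq> 0"
    by (simp add: e_def)
  have "x = y" if "\<chi> x = \<chi> y" for x y
  proof (cases "x = 0 \<or> y = 0")
    case True
    thus ?thesis
      using that e0 by (auto simp: \<chi>_def split: if_splits)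
  next
    case False
    hence "g ^ l x = g ^ l y"
      using that by (simp add: \<chi>_def e_iff g_iff)
    thus ?thesis
      using False l by simp
  qed
  hence "inj \<chi>"
    by (rule injI)
  moreover have "\<chi> 0 = 0"
    by (simp add: \<chi>_def)
  moreover have "\<chi> (x * y) = \<chi> x * \<chi> y" for x y
  proof (cases "x = 0 \<or> y = 0")
    case False
    hence "g ^ l (x * y) = g ^ (l x + l y)"
      using l by (simp add: power_add)
    hence "e ^ l (x * y) = e ^ (l x + l y)"
      by (simp only: g_iff e_iff)
    thus ?thesis
      using False by (simp add: \<chi>_def power_add)
  qed (auto simp: \<chi>_def)
  ultimately show ?thesis
    by (intro exI[of _ \<chi>] conjI allI)
qed


lemma card_roots_le:
  fixes f :: "'a::{comm_ring_1,ring_no_zero_divisors} poly"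
  assumes "degree f = m" "m > 0"
  shows "card {x. poly f x = b} \<le> m"
proof -
  have deg: "degree (f - [:b:]) = m"
    using assms by (simp add: diff_conv_add_uminus degree_add_eq_left del: add_uminus_conv_diff)
  hence "f - [:b:] \<noteq> 0"
    using assms(2) by auto
  hence "card {x. poly (f - [:b:]) x = 0} \<le> m"
    using card_poly_roots_bound deg by metis
  thus ?thesis
    by simp
qed

section \<open>The trace onto the subfield with \<open>q\<close> elements\<close>

locale finite_field_trace =
  fixes q n :: nat and K :: "'a::{field,finite} set"
  assumes q: "primepow q" and n: "n > 0"
    and card_field: "CARD('a) = q ^ n"
    and K: "is_subfield K" and card_K: "card K = q"
begin

lemma q_gt_1: "q > 1"
  using q primepow_gt_Suc_0 by auto

text \<open>The characteristic divides \<open>CARD('a)\<close>, a power of the prime below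
  \<open>q\<close>, so it is that prime. This makes raising to the power \<open>q ^ i\<close>
  additive.\<close>

lemma q_pow_CHAR: "\<exists>e. q = CHAR('a) ^ e" and prime_CHAR: "prime CHAR('a)"
proof -
  obtain p e where p: "prime p" "q = p ^ e"
    using q by (auto simp: primepow_def)
  show prime: "prime CHAR('a)"
    by (rule prime_CHAR_semidom) (simp add: finite_imp_CHAR_pos)
  have "CHAR('a) dvd p ^ (e * n)"
    using CHAR_dvd_CARD[where 'a = 'a] card_field p by (simp add: power_mult)
  hence "CHAR('a) = p"
    using prime p(1) prime_dvd_power primes_dvd_imp_eq by blast
  thus "\<exists>e. q = CHAR('a) ^ e"
    using p by blast
qed

lemma frobenius_sum: "sum f A ^ (q ^ i) = (\<Sum>x\<in>A. f x ^ (q ^ i :: nat))" for f :: "'b \<Rightarrow> 'a"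
proof -
  obtain e where "q = CHAR('a) ^ e"
    using q_pow_CHAR by blast
  thus ?thesis
    by (intro freshmans_dream_sum'[OF prime_CHAR, where n = "e * i"]) (simp add: power_mult)
qed

lemma frobenius_add: "(x + y) ^ (q ^ i) = x ^ (q ^ i) + y ^ (q ^ i)" for x y :: 'a
proof -
  obtain e where "q = CHAR('a) ^ e"
    using q_pow_CHAR by blast
  thus ?thesis
    by (intro freshmans_dream'[OF prime_CHAR, where n = "e * i"]) (simp add: power_mult)
qed

lemma Tr_add: "Tr q n (x + y) = Tr q n x + Tr q n y" for x y :: 'a
  by (simp add: Tr_def frobenius_add sum.distrib)

lemma Tr_diff: "Tr q n (x - y) = Tr q n x - Tr q n y" for x y :: 'a
  using Tr_add[of "x - y" y] by simp

lemma Tr_0: "Tr q n (0 :: 'a) = 0"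
  using Tr_diff[of 0 0] by simp

lemma K_power_q: "c \<in> K \<Longrightarrow> c ^ q = c"
  using subfield_power_card[OF K] card_K by simp

lemma Tr_mult: "Tr q n (c * x) = c * Tr q n x" if c: "c \<in> K" for c x :: 'a
proof -
  have "c ^ (q ^ i) = c" for i
    by (induction i) (simp_all add: power_mult K_power_q c)
  thus ?thesis
    by (simp add: Tr_def power_mult_distrib sum_distrib_left)
qed

text \<open>The polynomial X^q - X has at most \<open>q\<close> roots, and \<open>K\<close> already
  supplies \<open>q\<close> of them.\<close>

lemma fixed_points_frobenius: "{x :: 'a. x ^ q = x} = K"
proof (rule sym, rule card_seteq)
  define f :: "'a poly" where "f = monom 1 q - monom 1 1"
  have "degree f = q"
    unfolding f_def diff_conv_add_uminus using q_gt_1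
    by (subst degree_add_eq_left) (auto simp: degree_monom_eq)
  hence "card {x. poly f x = 0} \<le> q"
    using q_gt_1 by (intro card_roots_le) auto
  thus "card {x :: 'a. x ^ q = x} \<le> card K"
    by (simp add: f_def poly_monom card_K)
qed (use K_power_q in auto)

text \<open>Raising to the power \<open>q\<close> permutes the summands of the trace cyclically,
  because \<open>x ^ (q ^ n) = x\<close>. So the trace is a fixed point of this map.\<close>

lemma Tr_in_K: "Tr q n x \<in> K" for x :: 'a
proof -
  have "x ^ (q ^ n) = x"
    using subfield_power_card[of UNIV x] card_field by (simp add: is_subfield_def)
  have "Tr q n x ^ q = (\<Sum>i<n. x ^ q ^ Suc i)"
    using frobenius_sum[of "\<lambda>i. x ^ (q ^ i)" "{..<n}" 1]
    by (simp add: Tr_def mult.commute flip: power_mult)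
  also have "\<dots> + x = Tr q n x + x ^ (q ^ n)"
    unfolding Tr_def using sum.lessThan_Suc_shift[of "\<lambda>i. x ^ (q ^ i)" n] by simp
  finally have "Tr q n x ^ q = Tr q n x"
    using \<open>x ^ (q ^ n) = x\<close> by simp
  thus ?thesis
    using fixed_points_frobenius by blast
qed

text \<open>Each of the \<open>q\<close> fibres of the trace is the zero set of a polynomial of degree \<open>q ^ (n - 1)\<close>,
  and together they have \<open>q ^ n\<close> elements.\<close>

lemma card_Tr_fibre:
  assumes "b \<in> K"
  shows "card {x :: 'a. Tr q n x = b} = q ^ (n - 1)"
proof -
  define f :: "'a poly" where "f = (\<Sum>i<n. monom 1 (q ^ i))"
  have f: "poly f x = Tr q n x" for x
    by (simp add: f_def Tr_def poly_sum poly_monom)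
  have "coeff f (q ^ (n - 1)) = (\<Sum>i<n. if i = n - 1 then 1 else 0)"
    using q_gt_1 by (simp add: f_def coeff_sum cong: if_cong)
  hence "coeff f (q ^ (n - 1)) = 1"
    using n by simp
  moreover have "degree f \<le> q ^ (n - 1)"
    unfolding f_def using q_gt_1
    by (intro degree_sum_le) (auto simp: degree_monom_eq intro!: power_increasing)
  ultimately have "degree f = q ^ (n - 1)"
    using le_degree[of f "q ^ (n - 1)"] by simp
  hence le: "card {x. Tr q n x = b} \<le> q ^ (n - 1)" for b :: 'a
    using card_roots_le[of f "q ^ (n - 1)" b] q_gt_1 by (simp add: f)
  have "CARD('a) = card (\<Union>b\<in>K. {x. Tr q n x = b})"
    using Tr_in_K by (intro arg_cong[where f = card]) auto
  also have "\<dots> = (\<Sum>b\<in>K. card {x. Tr q n x = b})"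
    by (intro card_UN_disjoint) auto
  finally have "(\<Sum>b\<in>K. card {x. Tr q n x = b}) = (\<Sum>b\<in>K. q ^ (n - 1))"
    using n by (simp add: card_K card_field power_eq_if)
  thus ?thesis
    using sum_mono_inv[of "\<lambda>b. card {x. Tr q n x = b}" K "\<lambda>_. q ^ (n - 1)"] le assms by simp
qed

end


section \<open>Character sums over trace fibres\<close>

text \<open>With \<open>\<chi>\<close> injective, every multiplicative character is a power with
  some exponent \<open>j\<close>: the trivial one if \<open>N\<close> divides \<open>j\<close>, the
  quadratic one for \<open>j = N div 2\<close>.\<close>

locale finite_field_character = finite_field_trace q n K
  for q n and K :: "'a::{field,finite} set" +
  fixes \<chi> :: "'a \<Rightarrow> complex"
  assumes odd_q: "odd q"
    and inj_\<chi>: "inj \<chi>" and \<chi>_0: "\<chi> 0 = 0" and \<chi>_mult: "\<chi> (x * y) = \<chi> x * \<chi> y"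
begin

definition N :: nat where "N = q ^ n - 1"

lemma Suc_N: "Suc N = q ^ n"
  using q_gt_1 by (simp add: N_def)

lemma even_N: "even N"
  using Suc_N odd_q n by (metis even_Suc even_power)

lemma N_gt_1: "N > 1"
proof -
  have "q ^ n > 1"
    using q_gt_1 n by (rule one_less_power)
  thus ?thesis
    using Suc_N even_N by (cases N; cases "N - 1") auto
qed

lemma \<chi>_eq_iff: "\<chi> x = \<chi> y \<longleftrightarrow> x = y"
  using inj_\<chi> by (auto simp: inj_def)

lemma \<chi>_eq_0_iff: "\<chi> x = 0 \<longleftrightarrow> x = 0"
  using \<chi>_eq_iff[of x 0] \<chi>_0 by simp

lemma \<chi>_1: "\<chi> 1 = 1"
  using \<chi>_mult[of 1 1] \<chi>_eq_0_iff[of 1] by simp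

lemma \<chi>_power: "\<chi> (x ^ i) = \<chi> x ^ i"
  by (induction i) (simp_all add: \<chi>_1 \<chi>_mult)

lemma \<chi>_power_N: "x \<noteq> 0 \<Longrightarrow> \<chi> x ^ N = 1"
  using finite_field_power_card_minus_1[of x] card_field by (simp add: N_def \<chi>_1 flip: \<chi>_power)

lemma norm_\<chi>: "x \<noteq> 0 \<Longrightarrow> norm (\<chi> x) = 1"
  using \<chi>_power_N[of x] N_gt_1 power_eq_1_iff[of "\<chi> x" N] by simp

text \<open>The \<open>N\<close> nonzero elements are mapped injectively into the \<open>N\<close>
  complex roots of unity of order dividing \<open>N\<close>.\<close>

lemma \<chi>_surj:
  assumes "z ^ N = 1"
  shows "\<exists>x. x \<noteq> 0 \<and> \<chi> x = z"
proof -
  have "\<chi> ` (UNIV - {0}) = {z. z ^ N = 1}"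
  proof (rule card_subset_eq)
    show "finite {z::complex. z ^ N = 1}"
      using N_gt_1 by (intro finite_roots_unity) auto
    have "card (\<chi> ` (UNIV - {0})) = card (UNIV - {0::'a})"
      using inj_\<chi> by (intro card_image) (auto simp: inj_on_def)
    also have "\<dots> = N"
      by (simp add: card_Diff_singleton card_field N_def)
    also have "\<dots> = card {z::complex. z ^ N = 1}"
      using N_gt_1 by (simp add: card_roots_unity_eq)
    finally show "card (\<chi> ` (UNIV - {0})) = card {z::complex. z ^ N = 1}" .
  qed (auto simp: \<chi>_power_N)
  hence "z \<in> \<chi> ` (UNIV - {0})"
    using assms by simp
  thus ?thesis
    by auto
qed

text \<open>Orthogonality: multiplying the variable by an \<open>a\<close> with
  \<open>\<chi> a ^ j \<noteq> 1\<close> rescales the sum without changing it. A preimage of a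
  primitive root of unity serves as \<open>a\<close>.\<close>

lemma sum_\<chi>_power:
  assumes "\<not> N dvd j"
  shows "(\<Sum>x\<in>UNIV - {0}. \<chi> x ^ j) = 0"
proof -
  have "cis (2 * pi / real N) ^ N = 1"
    using N_gt_1 by (simp add: DeMoivre)
  then obtain a where a: "a \<noteq> 0" "\<chi> a = cis (2 * pi / real N)"
    using \<chi>_surj by blast
  have a_j: "\<chi> a ^ j \<noteq> 1"
  proof
    assume "\<chi> a ^ j = 1"
    hence "cis (real j * (2 * pi / real N)) = 1"
      by (simp add: a DeMoivre)
    then obtain m :: int where "real j * (2 * pi / real N) = of_int m * 2 * pi"
      by (auto simp: complex_eq_iff cos_one_2pi_int)
    hence "real j = of_int m * real N"
      using N_gt_1 by (simp add: field_simps)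
    hence "int j = m * int N"
      by (metis (no_types, lifting) of_int_eq_iff of_int_mult of_int_of_nat_eq)
    hence "int N dvd int j"
      by simp
    thus False
      using assms by simp
  qed
  have "(\<Sum>x\<in>UNIV - {0}. \<chi> x ^ j) = (\<Sum>x\<in>UNIV - {0}. \<chi> (a * x) ^ j)"
    by (rule sum.reindex_bij_witness[where i = "\<lambda>x. a * x" and j = "\<lambda>x. x / a"]) (use a in auto)
  also have "\<dots> = \<chi> a ^ j * (\<Sum>x\<in>UNIV - {0}. \<chi> x ^ j)"
    by (simp add: \<chi>_mult power_mult_distrib sum_distrib_left)
  finally show ?thesis
    using a_j by simp
qed

text \<open>This is U_b of the overview for the character with exponent \<open>j\<close>. Zero is
  excluded explicitly because \<open>\<chi> 0 ^ 0 = 1\<close>.\<close>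

definition trace_sum :: "'a \<Rightarrow> nat \<Rightarrow> complex"
  where "trace_sum b j = (\<Sum>y | y \<noteq> 0 \<and> Tr q n y = b. \<chi> y ^ j)"

text \<open>By linearity of the trace, \<open>y \<mapsto> c * y\<close> carries the fibre over
  \<open>b\<close> to that over \<open>c * b\<close>, at the cost of the factor
  \<open>\<chi> c ^ j\<close> of norm 1.\<close>

lemma norm_trace_sum_scale:
  assumes "c \<in> K" "c \<noteq> 0"
  shows "norm (trace_sum (c * b) j) = norm (trace_sum b j)"
proof -
  have inv: "inverse c \<in> K"
    using K assms by (auto simp: is_subfield_def)
  have "trace_sum (c * b) j = (\<Sum>y | y \<noteq> 0 \<and> Tr q n y = b. \<chi> (c * y) ^ j)"
    unfolding trace_sum_def
    by (rule sum.reindex_bij_witness[where i = "\<lambda>x. c * x" and j = "\<lambda>x. inverse c * x"])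
       (use assms inv in \<open>auto simp: Tr_mult mult.assoc[symmetric]\<close>)
  also have "\<dots> = \<chi> c ^ j * trace_sum b j"
    by (simp add: trace_sum_def \<chi>_mult power_mult_distrib sum_distrib_left)
  finally show ?thesis
    using assms by (simp add: norm_mult norm_power norm_\<chi>)
qed

text \<open>For \<open>a \<noteq> 0\<close>, multiplication by \<open>a\<close> is a bijection onto
  the kernel of the trace; the final 1 accounts for \<open>z = 0\<close>.\<close>

lemma card_Tr_mult_eq_0:
  "real (card {z. z \<noteq> 0 \<and> Tr q n (a * z) = 0}) = (if a = 0 then real q ^ n else real q ^ (n - 1)) - 1"
  for a :: 'a
proof -
  have "card {z. Tr q n (a * z) = 0} = Suc (card ({z. Tr q n (a * z) = 0} - {0}))"
    by (intro card.remove) (auto simp: Tr_0)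
  moreover have "{z. Tr q n (a * z) = 0} - {0} = {z. z \<noteq> 0 \<and> Tr q n (a * z) = 0}"
    by auto
  moreover have "card {z. Tr q n (a * z) = 0} = (if a = 0 then q ^ n else q ^ (n - 1))"
  proof (cases "a = 0")
    case False
    have "card {z. Tr q n (a * z) = 0} = card {z::'a. Tr q n z = 0}"
      by (rule bij_betw_same_card[where f = "\<lambda>z. a * z"],
          rule bij_betw_byWitness[where f' = "\<lambda>z. z / a"]) (use False in auto)
    thus ?thesis
      using False card_Tr_fibre[of 0] K by (simp add: is_subfield_def)
  qed (simp add: Tr_0 card_field)
  ultimately have "Suc (card {z. z \<noteq> 0 \<and> Tr q n (a * z) = 0}) = (if a = 0 then q ^ n else q ^ (n - 1))"
    by simp
  hence "real (Suc (card {z. z \<noteq> 0 \<and> Tr q n (a * z) = 0})) = real (if a = 0 then q ^ n else q ^ (n - 1))"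
    by (rule arg_cong)
  thus ?thesis
    unfolding of_nat_Suc if_distrib[of real] of_nat_power by linarith
qed

text \<open>The squared norms expand into a sum over pairs of nonzero \<open>y\<close> and
  \<open>z\<close> of equal trace. Writing \<open>y = t * z\<close> turns it into a character sum
  over \<open>t\<close>, weighted by the number of \<open>z\<close> with
  \<open>Tr q n ((t - 1) * z) = 0\<close>.\<close>

lemma sum_norm_trace_sum_square:
  assumes "\<not> N dvd j"
  shows "(\<Sum>b\<in>K. (norm (trace_sum b j))\<^sup>2) = real q ^ (n - 1) * (real q - 1)"
proof -
  have "complex_of_real (\<Sum>b\<in>K. (norm (trace_sum b j))\<^sup>2) = (\<Sum>b\<in>K. cnj (trace_sum b j) * trace_sum b j)"
    unfolding of_real_sum complex_norm_square by (intro sum.cong refl mult.commute)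
  also have "\<dots> = (\<Sum>b\<in>K. \<Sum>z | z \<in> UNIV - {0} \<and> Tr q n z = b. \<Sum>y | y \<noteq> 0 \<and> Tr q n y = Tr q n z.
      cnj (\<chi> z ^ j) * \<chi> y ^ j)"
    by (simp add: trace_sum_def sum_product)
  also have "\<dots> = (\<Sum>z\<in>UNIV - {0}. \<Sum>y | y \<noteq> 0 \<and> Tr q n y = Tr q n z. cnj (\<chi> z ^ j) * \<chi> y ^ j)"
    by (rule sum.group) (auto simp: Tr_in_K)
  also have "\<dots> = (\<Sum>z\<in>UNIV - {0}. \<Sum>t | t \<noteq> 0 \<and> Tr q n ((t - 1) * z) = 0. \<chi> t ^ j)"
  proof (rule sum.cong[OF refl])
    fix z :: 'a
    assume "z \<in> UNIV - {0}"
    hence z: "z \<noteq> 0"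
      by simp
    have "cnj (\<chi> z) * \<chi> z = 1"
      using norm_\<chi>[OF z] by (metis complex_norm_square mult.commute of_real_1 power_one)
    hence cancel: "cnj (\<chi> z ^ j) * \<chi> (t * z) ^ j = \<chi> t ^ j" for t
      by (simp add: \<chi>_mult mult.left_commute mult.commute flip: power_mult_distrib)
    have "(\<Sum>y | y \<noteq> 0 \<and> Tr q n y = Tr q n z. cnj (\<chi> z ^ j) * \<chi> y ^ j) =
        (\<Sum>t | t \<noteq> 0 \<and> Tr q n ((t - 1) * z) = 0. cnj (\<chi> z ^ j) * \<chi> (t * z) ^ j)"
      by (rule sum.reindex_bij_witness[where i = "\<lambda>t. t * z" and j = "\<lambda>y. y / z"])
         (use z in \<open>auto simp: left_diff_distrib Tr_diff\<close>)
    thus "(\<Sum>y | y \<noteq> 0 \<and> Tr q n y = Tr q n z. cnj (\<chi> z ^ j) * \<chi> y ^ j) =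
        (\<Sum>t | t \<noteq> 0 \<and> Tr q n ((t - 1) * z) = 0. \<chi> t ^ j)"
      by (simp only: cancel)
  qed
  also have "\<dots> = (\<Sum>z\<in>UNIV - {0}. \<Sum>t\<in>UNIV - {0}. if Tr q n ((t - 1) * z) = 0 then \<chi> t ^ j else 0)"
    by (intro sum.cong refl sum.mono_neutral_cong_left) auto
  also have "\<dots> = (\<Sum>t\<in>UNIV - {0}. \<Sum>z\<in>UNIV - {0}. if Tr q n ((t - 1) * z) = 0 then \<chi> t ^ j else 0)"
    by (rule sum.swap)
  also have "\<dots> = (\<Sum>t\<in>UNIV - {0}. of_real (card {z. z \<noteq> 0 \<and> Tr q n ((t - 1) * z) = 0}) * \<chi> t ^ j)"
    by (intro sum.cong refl) (simp flip: sum.inter_filter)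
  \<comment> \<open>The weight is constant except for an excess at \<open>t = 1\<close>;
    orthogonality kills the constant part.\<close>
  also have "\<dots> = (\<Sum>t\<in>UNIV - {0}. (of_nat q ^ (n - 1) - 1) * \<chi> t ^ j +
      (if t = 1 then of_nat q ^ n - of_nat q ^ (n - 1) else 0))"
    unfolding card_Tr_mult_eq_0 by (intro sum.cong) (auto simp: \<chi>_1)
  also have "\<dots> = of_nat q ^ n - of_nat q ^ (n - 1)"
    by (simp add: sum.distrib sum_\<chi>_power[OF assms] flip: sum_distrib_left)
  also have "\<dots> = of_real (real q ^ (n - 1) * (real q - 1))"
    using n by (simp add: power_eq_if[of _ n] algebra_simps)
  finally show ?thesis
    by (simp only: of_real_eq_iff)
qed

text \<open>The \<open>q - 1\<close> nonzero traces give equal norms, whose squares sum to at most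
  \<open>(q - 1) * q ^ (n - 1)\<close>.\<close>

lemma norm_trace_sum_le:
  assumes "\<not> N dvd j" "b \<in> K" "b \<noteq> 0"
  shows "norm (trace_sum b j) \<le> sqrt (real q ^ (n - 1))"
proof -
  have "norm (trace_sum c j) = norm (trace_sum b j)" if "c \<in> K - {0}" for c
  proof -
    have "c * inverse b \<in> K" "c * inverse b \<noteq> 0"
      using that assms K by (auto simp: is_subfield_def)
    moreover have "c * inverse b * b = c"
      using assms by simp
    ultimately show ?thesis
      using norm_trace_sum_scale by metis
  qed
  hence "(real q - 1) * (norm (trace_sum b j))\<^sup>2 = (\<Sum>c\<in>K - {0}. (norm (trace_sum c j))\<^sup>2)"
    using q_gt_1 K by (simp add: card_K is_subfield_def card_Diff_singleton of_nat_diff)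
  also have "\<dots> \<le> (\<Sum>c\<in>K. (norm (trace_sum c j))\<^sup>2)"
    by (intro sum_mono2) auto
  also have "\<dots> = (real q - 1) * real q ^ (n - 1)"
    by (simp add: sum_norm_trace_sum_square[OF assms(1)])
  finally have "(norm (trace_sum b j))\<^sup>2 \<le> real q ^ (n - 1)"
    using q_gt_1 by simp
  thus ?thesis
    by (rule real_le_rsqrt)
qed

section \<open>Character sums over elements whose square has a given trace\<close>

definition square_trace_sum :: "'a \<Rightarrow> nat \<Rightarrow> complex"
  where "square_trace_sum b j = (\<Sum>x | x \<noteq> 0 \<and> Tr q n (x\<^sup>2) = b. \<chi> x ^ j)"

lemma minus_neq: "x \<noteq> 0 \<Longrightarrow> - x \<noteq> x" for x :: 'a
proof
  assume x: "x \<noteq> 0" "- x = x"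
  hence "2 * x = 0"
    by (metis add.right_inverse mult_2)
  hence "of_nat 2 = (0 :: 'a)"
    using x by simp
  hence "CHAR('a) dvd 2"
    by (simp only: of_nat_eq_0_iff_char_dvd)
  hence "CHAR('a) = 2"
    using prime_CHAR primes_dvd_imp_eq two_is_prime_nat by blast
  moreover have "odd CARD('a)"
    using odd_q by (simp add: card_field)
  ultimately show False
    using CHAR_dvd_CARD[where 'a = 'a] by simp
qed

text \<open>The range of summation is invariant under negation, whereas the summand changes sign
  because \<open>\<chi> (- 1) = - 1\<close>.\<close>

lemma square_trace_sum_odd:
  assumes "odd j"
  shows "square_trace_sum b j = 0"
proof -
  have "\<chi> (- 1) * \<chi> (- 1) = 1"
    using \<chi>_mult[of "- 1" "- 1"] by (simp add: \<chi>_1)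
  moreover have "\<chi> (- 1) \<noteq> 1"
    using \<chi>_eq_iff[of "- 1" 1] \<chi>_1 minus_neq[of 1] by simp
  ultimately have m1: "\<chi> (- 1) = - 1"
    by (simp add: square_eq_1_iff)
  have "square_trace_sum b j = (\<Sum>x | x \<noteq> 0 \<and> Tr q n (x\<^sup>2) = b. \<chi> (- x) ^ j)"
    unfolding square_trace_sum_def by (rule sum.reindex_bij_witness[where i = uminus and j = uminus]) auto
  also have "\<dots> = - square_trace_sum b j"
    using \<chi>_mult[of "- 1"] assms by (simp add: square_trace_sum_def m1 sum_negf)
  finally show ?thesis
    by simp
qed

text \<open>\<open>\<chi> y ^ (N div 2)\<close> is the quadratic character: 1 on nonzero squares and
  -1 on non-squares.\<close>

lemma card_square_roots:
  assumes "y \<noteq> 0"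
  shows "of_nat (card {x. x\<^sup>2 = y}) = 1 + \<chi> y ^ (N div 2)"
proof (cases "\<exists>x. x\<^sup>2 = y")
  case True
  then obtain x where x: "x\<^sup>2 = y"
    by blast
  have "x \<noteq> 0"
    using assms x by auto
  moreover have "{x. x\<^sup>2 = y} = {x, - x}"
    using x by (auto simp: power2_eq_iff)
  moreover have "\<chi> y ^ (N div 2) = \<chi> x ^ N"
    using even_N by (simp add: x[symmetric] \<chi>_power flip: power_mult)
  ultimately show ?thesis
    using minus_neq[of x] \<chi>_power_N[of x] by (auto simp: card_insert_if)
next
  case False
  have "\<chi> y ^ (N div 2) \<noteq> 1"
  proof
    assume "\<chi> y ^ (N div 2) = 1"
    \<comment> \<open>The complex square root of \<open>\<chi> y\<close> would then be a value
      \<open>\<chi> x\<close>, and injectivity would force \<open>x\<^sup>2 = y\<close>.\<close>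
    hence "csqrt (\<chi> y) ^ N = 1"
      using even_N by (metis dvd_mult_div_cancel power2_csqrt power_mult)
    then obtain x where "\<chi> x = csqrt (\<chi> y)"
      using \<chi>_surj by blast
    hence "\<chi> (x\<^sup>2) = \<chi> y"
      by (simp add: \<chi>_power)
    thus False
      using False \<chi>_eq_iff by blast
  qed
  moreover have "(\<chi> y ^ (N div 2))\<^sup>2 = 1"
    using even_N \<chi>_power_N[OF assms] by (simp flip: power_mult)
  ultimately have "\<chi> y ^ (N div 2) = - 1"
    by (simp add: power2_eq_1_iff)
  moreover have "{x. x\<^sup>2 = y} = {}"
    using False by auto
  ultimately show ?thesis
    by (simp only: card.empty) simp
qed

text \<open>The elements are grouped by their square \<open>y\<close>, and the number of square
  roots of \<open>y\<close> is expressed by the quadratic character.\<close>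

lemma square_trace_sum_even: "square_trace_sum b (2 * i) = trace_sum b i + trace_sum b (i + N div 2)"
proof -
  have "square_trace_sum b (2 * i) = (\<Sum>y | y \<noteq> 0 \<and> Tr q n y = b.
      \<Sum>x | x \<in> {x. x \<noteq> 0 \<and> Tr q n (x\<^sup>2) = b} \<and> x\<^sup>2 = y. \<chi> x ^ (2 * i))"
    unfolding square_trace_sum_def by (rule sum.group[symmetric]) auto
  also have "\<dots> = (\<Sum>y | y \<noteq> 0 \<and> Tr q n y = b. \<Sum>x | x\<^sup>2 = y. \<chi> y ^ i)"
    by (intro sum.cong) (auto simp: \<chi>_power power_mult)
  also have "\<dots> = (\<Sum>y | y \<noteq> 0 \<and> Tr q n y = b. (1 + \<chi> y ^ (N div 2)) * \<chi> y ^ i)"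
    by (intro sum.cong) (auto simp: card_square_roots)
  also have "\<dots> = trace_sum b i + trace_sum b (i + N div 2)"
    by (simp add: trace_sum_def distrib_right sum.distrib power_add) (simp add: mult.commute)
  finally show ?thesis .
qed

text \<open>For \<open>j = 2 * i\<close>, both \<open>i\<close> and \<open>i + N div 2\<close>
  double to \<open>j\<close> modulo \<open>N\<close>, so neither belongs to the trivial
  character.\<close>

lemma norm_square_trace_sum_le:
  assumes "\<not> N dvd j" "b \<in> K" "b \<noteq> 0"
  shows "norm (square_trace_sum b j) \<le> 2 * sqrt (real q ^ (n - 1))"
proof (cases "even j")
  case True
  then obtain i where i: "j = 2 * i"
    by blast
  have "\<not> N dvd i"
    using assms(1) i by auto
  moreover have "\<not> N dvd i + N div 2"
  proof
    assume "N dvd i + N div 2"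
    hence "N dvd 2 * (i + N div 2)"
      by (rule dvd_mult)
    hence "N dvd j + N"
      using even_N i by (simp add: distrib_left)
    thus False
      using assms(1) by simp
  qed
  ultimately have "norm (trace_sum b i) + norm (trace_sum b (i + N div 2)) \<le> 2 * sqrt (real q ^ (n - 1))"
    using norm_trace_sum_le[of i b] norm_trace_sum_le[of "i + N div 2" b] assms by simp
  thus ?thesis
    unfolding i square_trace_sum_even using norm_triangle_ineq order_trans by blast
qed (simp add: square_trace_sum_odd)

text \<open>The trivial character counts a trace fibre exactly; the error comes from the quadratic
  character alone.\<close>

lemma Re_square_trace_sum_0_ge:
  assumes "b \<in> K" "b \<noteq> 0"
  shows "Re (square_trace_sum b 0) \<ge> real q ^ (n - 1) - sqrt (real q ^ (n - 1))"
proof -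
  have "{y. y \<noteq> 0 \<and> Tr q n y = b} = {y. Tr q n y = b}"
    using assms Tr_0 by auto
  hence "trace_sum b 0 = of_nat (q ^ (n - 1))"
    using card_Tr_fibre[OF assms(1)] by (simp add: trace_sum_def)
  moreover have "\<not> N dvd N div 2"
    using N_gt_1 by (auto dest!: dvd_imp_le)
  hence "Re (trace_sum b (N div 2)) \<ge> - sqrt (real q ^ (n - 1))"
    using norm_trace_sum_le[of "N div 2" b] abs_Re_le_cmod[of "trace_sum b (N div 2)"] assms by linarith
  ultimately show ?thesis
    using square_trace_sum_even[of b 0] by simp
qed


section \<open>The sieve\<close>

text \<open>For a prime \<open>l\<close> dividing \<open>N\<close>, this sums the values at
  \<open>x\<close> of all characters of order \<open>l\<close>.\<close>

definition residue_sum :: "nat \<Rightarrow> 'a \<Rightarrow> complex"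
  where "residue_sum l x = (\<Sum>i\<in>{1..<l}. \<chi> x ^ (i * (N div l)))"

text \<open>The geometric sum makes \<open>residue_sum l x\<close> equal to \<open>l - 1\<close> or
  \<open>- 1\<close>, according to whether \<open>x\<close> is an \<open>l\<close>-th power.
  Extracting the factor \<open>1 - 1 / l\<close> normalises the trivial character to coefficient
  1.\<close>

lemma of_bool_not_residue:
  assumes "prime l" "l dvd N" "x \<noteq> 0"
  shows "of_bool (\<chi> x ^ (N div l) \<noteq> 1) = of_real (1 - 1 / real l) * (1 + - residue_sum l x / of_real (real l - 1))"
proof -
  define w where "w = \<chi> x ^ (N div l)"
  have l: "l > 1"
    using assms(1) prime_gt_1_nat by blast
  have "{..<l} = insert 0 {1..<l}"
    using l by auto
  hence "(\<Sum>i<l. w ^ i) = 1 + residue_sum l x"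
    by (simp add: residue_sum_def w_def mult.commute flip: power_mult)
  moreover have "w ^ l = 1"
    using \<chi>_power_N[OF assms(3)] assms(2) by (simp add: w_def flip: power_mult)
  ultimately have "residue_sum l x = (if w = 1 then of_nat l - 1 else - 1)"
    using geometric_sum[of w l] by (cases "w = 1") (auto simp: add_eq_0_iff eq_diff_eq add.commute)
  moreover have "of_nat l \<noteq> (1::complex)"
    using l by (metis less_irrefl of_nat_1 of_nat_eq_iff)
  ultimately show ?thesis
    unfolding w_def[symmetric] using l by (auto simp: field_simps)
qed

text \<open>For a set \<open>D\<close> of primes with product d, this is the part of the expansion
  belonging to the characters of order exactly d; their common coefficient is mu(d)/phi(d).\<close>

definition sieve_term :: "'a \<Rightarrow> nat set \<Rightarrow> complex"
  where "sieve_term b D = (\<Sum>x | x \<noteq> 0 \<and> Tr q n (x\<^sup>2) = b. \<Prod>l\<in>D. - residue_sum l x / of_real (real l - 1))"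

definition prime_divisors :: "nat set \<Rightarrow> bool"
  where "prime_divisors P \<longleftrightarrow> finite P \<and> (\<forall>l\<in>P. prime l \<and> l dvd N)"

text \<open>A product of characters of distinct prime orders is nontrivial. Multiplying the exponent
  by the other primes makes all terms but that of \<open>l\<close> vanish modulo \<open>N\<close>,
  so \<open>l\<close> would divide one of those primes or \<open>h l < l\<close>.\<close>

lemma not_dvd_sum_cofactors:
  assumes "prime_divisors D" "D \<noteq> {}" "h \<in> (\<Pi>\<^sub>E l\<in>D. {1..<l})"
  shows "\<not> N dvd (\<Sum>l\<in>D. h l * (N div l))"
proof
  assume N: "N dvd (\<Sum>l\<in>D. h l * (N div l))"
  obtain l where l: "l \<in> D"
    using assms(2) by blast
  have fin: "finite D" and D: "\<And>l. l \<in> D \<Longrightarrow> prime l \<and> l dvd N"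
    using assms(1) by (auto simp: prime_divisors_def)
  define m where "m = \<Prod>(D - {l})"
  have "N dvd m * (\<Sum>l\<in>D. h l * (N div l))"
    using N by (rule dvd_mult)
  also have "m * (\<Sum>l\<in>D. h l * (N div l)) =
      m * (h l * (N div l)) + (\<Sum>l'\<in>D - {l}. m * (h l' * (N div l')))"
    using fin l by (simp add: sum.remove[of D l] sum_distrib_left distrib_left)
  finally have "N dvd m * (h l * (N div l)) + (\<Sum>l'\<in>D - {l}. m * (h l' * (N div l')))" .
  moreover have "N dvd (\<Sum>l'\<in>D - {l}. m * (h l' * (N div l')))"
  proof (rule dvd_sum)
    fix l' assume l': "l' \<in> D - {l}"
    have "l' dvd m"
      unfolding m_def using fin l' by (intro dvd_prodI[where f = "\<lambda>x. x", simplified]) auto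
    then obtain c where c: "m = l' * c"
      by blast
    have "m * (h l' * (N div l')) = N * (c * h l')"
      using D[of l'] l' by (simp add: c mult_ac)
    thus "N dvd m * (h l' * (N div l'))"
      by (simp only: dvd_triv_left)
  qed
  ultimately have "N dvd m * (h l * (N div l))"
    using dvd_add_left_iff by blast
  hence "l * (N div l) dvd m * h l * (N div l)"
    using D[OF l] by (simp add: mult.assoc)
  moreover have "N div l > 0"
    using D[OF l] N_gt_1 by (simp add: div_greater_zero_iff dvd_imp_le prime_gt_0_nat)
  ultimately have "l dvd m * h l"
    by simp
  hence "l dvd m \<or> l dvd h l"
    using D[OF l] prime_dvd_mult_iff by blast
  moreover have "\<not> l dvd m"
  proof
    assume "l dvd m"
    then obtain l' where "l' \<in> D - {l}" "l dvd l'"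
      unfolding m_def using prime_dvd_prod_iff[of "D - {l}" l "\<lambda>x. x"] fin D[OF l] by auto
    thus False
      using D l primes_dvd_imp_eq by blast
  qed
  moreover have "h l \<in> {1..<l}"
    using assms(3) l by auto
  hence "\<not> l dvd h l"
    by (auto dest: dvd_imp_le)
  ultimately show False
    by blast
qed

text \<open>The product expands into as many nontrivial characters as the product of the
  \<open>l - 1\<close>, which is exactly the denominator of the coefficient. The bound for a single
  character therefore survives.\<close>

lemma norm_sieve_term_le:
  assumes "prime_divisors D" "D \<noteq> {}" "b \<in> K" "b \<noteq> 0"
  shows "norm (sieve_term b D) \<le> 2 * sqrt (real q ^ (n - 1))"
proof -
  have fin: "finite D" and gt: "\<And>l. l \<in> D \<Longrightarrow> l > 1"
    using assms(1) prime_gt_1_nat by (auto simp: prime_divisors_def)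
  define c where "c = (\<Prod>l\<in>D. real l - 1)"
  have c: "c > 0"
    unfolding c_def using gt by (intro prod_pos) auto
  have "(\<Prod>l\<in>D. residue_sum l x) = (\<Sum>h\<in>(\<Pi>\<^sub>E l\<in>D. {1..<l}). \<chi> x ^ (\<Sum>l\<in>D. h l * (N div l)))" for x
    unfolding residue_sum_def using fin by (subst prod_sum_PiE) (auto simp: power_sum)
  hence "(\<Sum>x | x \<noteq> 0 \<and> Tr q n (x\<^sup>2) = b. \<Prod>l\<in>D. residue_sum l x) =
      (\<Sum>h\<in>(\<Pi>\<^sub>E l\<in>D. {1..<l}). square_trace_sum b (\<Sum>l\<in>D. h l * (N div l)))"
    unfolding square_trace_sum_def by (subst sum.swap) simp
  moreover have "sieve_term b D = (- 1) ^ card D / of_real c * (\<Sum>x | x \<noteq> 0 \<and> Tr q n (x\<^sup>2) = b. \<Prod>l\<in>D. residue_sum l x)"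
    unfolding sieve_term_def sum_distrib_left using fin
    by (intro sum.cong refl) (simp add: c_def prod_dividef prod_uminus)
  ultimately have "norm (sieve_term b D) = norm (\<Sum>h\<in>(\<Pi>\<^sub>E l\<in>D. {1..<l}). square_trace_sum b (\<Sum>l\<in>D. h l * (N div l))) / c"
    using c by (simp add: norm_mult norm_divide norm_power)
  also have "\<dots> \<le> (\<Sum>h\<in>(\<Pi>\<^sub>E l\<in>D. {1..<l}). 2 * sqrt (real q ^ (n - 1))) / c"
    using c assms by (intro divide_right_mono sum_norm_le norm_square_trace_sum_le not_dvd_sum_cofactors) auto
  also have "(\<Sum>h\<in>(\<Pi>\<^sub>E l\<in>D. {1..<l}). 2 * sqrt (real q ^ (n - 1))) = c * (2 * sqrt (real q ^ (n - 1)))"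
  proof -
    have "(\<Prod>l\<in>D. real (l - 1)) = c"
      unfolding c_def by (intro prod.cong refl) (metis gt less_imp_le of_nat_1 of_nat_diff)
    thus ?thesis
      using fin by (simp add: card_PiE)
  qed
  finally show ?thesis
    using c by simp
qed

text \<open>For \<open>l\<close> dividing \<open>N\<close>, the condition says that \<open>x\<close>
  is not an \<open>l\<close>-th power. For primes \<open>P\<close> this is thus the count of m-free
  elements, where m is their product, and \<open>density P\<close> is \<open>\<theta>\<close> of
  m.\<close>

definition nonresidue_count :: "'a \<Rightarrow> nat set \<Rightarrow> nat"
  where "nonresidue_count b P = card {x. x \<noteq> 0 \<and> Tr q n (x\<^sup>2) = b \<and> (\<forall>l\<in>P. \<chi> x ^ (N div l) \<noteq> 1)}"

definition density :: "nat set \<Rightarrow> real"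
  where "density P = (\<Prod>l\<in>P. 1 - 1 / real l)"

lemma density_nonneg: "prime_divisors P \<Longrightarrow> density P \<ge> 0"
  unfolding density_def by (intro prod_nonneg) (auto simp: prime_divisors_def dest!: prime_gt_1_nat)

lemma nonresidue_count_expansion:
  assumes "prime_divisors P"
  shows "of_nat (nonresidue_count b P) = of_real (density P) * (\<Sum>D\<in>Pow P. sieve_term b D)"
proof -
  have fin: "finite P" and P: "\<And>l. l \<in> P \<Longrightarrow> prime l \<and> l dvd N"
    using assms by (auto simp: prime_divisors_def)
  have "(of_nat (nonresidue_count b P) :: complex) =
      (\<Sum>x | x \<noteq> 0 \<and> Tr q n (x\<^sup>2) = b. of_bool (\<forall>l\<in>P. \<chi> x ^ (N div l) \<noteq> 1))"
    by (simp add: nonresidue_count_def Int_def conj_ac)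
  also have "\<dots> = (\<Sum>x | x \<noteq> 0 \<and> Tr q n (x\<^sup>2) = b. of_real (density P) *
      (\<Sum>D\<in>Pow P. \<Prod>l\<in>D. - residue_sum l x / of_real (real l - 1)))"
  proof (rule sum.cong[OF refl])
    fix x
    assume "x \<in> {x. x \<noteq> 0 \<and> Tr q n (x\<^sup>2) = b}"
    hence x: "x \<noteq> 0"
      by simp
    have "(of_bool (\<forall>l\<in>P. \<chi> x ^ (N div l) \<noteq> 1) :: complex) = (\<Prod>l\<in>P. of_bool (\<chi> x ^ (N div l) \<noteq> 1))"
      using fin by induction auto
    also have "\<dots> = (\<Prod>l\<in>P. of_real (1 - 1 / real l) * (- residue_sum l x / of_real (real l - 1) + 1))"
      using of_bool_not_residue P x by (intro prod.cong refl) (simp add: add.commute)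
    also have "\<dots> = of_real (density P) * (\<Prod>l\<in>P. - residue_sum l x / of_real (real l - 1) + 1)"
      by (simp add: prod.distrib density_def)
    also have "(\<Prod>l\<in>P. - residue_sum l x / of_real (real l - 1) + 1) = (\<Sum>D\<in>Pow P. \<Prod>l\<in>D. - residue_sum l x / of_real (real l - 1))"
      using prod_add[OF fin, of "\<lambda>l. - residue_sum l x / of_real (real l - 1)" "\<lambda>_. 1"]
      by (simp only: prod.neutral_const mult_1_right)
    finally show "of_bool (\<forall>l\<in>P. \<chi> x ^ (N div l) \<noteq> 1) = of_real (density P) *
        (\<Sum>D\<in>Pow P. \<Prod>l\<in>D. - residue_sum l x / of_real (real l - 1))" .
  qed
  also have "\<dots> = of_real (density P) * (\<Sum>D\<in>Pow P. sieve_term b D)"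
    unfolding sum_distrib_left[symmetric] sieve_term_def by (subst sum.swap) simp
  finally show ?thesis .
qed

text \<open>The empty subset yields the main term, and each nonempty subset of \<open>P\<close>
  costs at most the bound for one sieve term.\<close>

lemma nonresidue_count_ge:
  assumes P: "prime_divisors P" and b: "b \<in> K" "b \<noteq> 0"
  shows "real (nonresidue_count b P) \<ge> density P * (real q ^ (n - 1) - 2 ^ card P * (2 * sqrt (real q ^ (n - 1))))"
proof -
  define B where "B = sqrt (real q ^ (n - 1))"
  have fin: "finite P"
    using P by (simp add: prime_divisors_def)
  have "- (\<Sum>D\<in>Pow P - {{}}. 2 * B) \<le> Re (\<Sum>D\<in>Pow P - {{}}. sieve_term b D)"
  proof -
    have "norm (\<Sum>D\<in>Pow P - {{}}. sieve_term b D) \<le> (\<Sum>D\<in>Pow P - {{}}. 2 * B)"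
      unfolding B_def using P b fin
      by (intro sum_norm_le norm_sieve_term_le) (auto simp: prime_divisors_def intro: finite_subset)
    thus ?thesis
      using abs_Re_le_cmod[of "\<Sum>D\<in>Pow P - {{}}. sieve_term b D"] by linarith
  qed
  moreover have "(\<Sum>D\<in>Pow P - {{}}. 2 * B) = (2 ^ card P - 1) * (2 * B)"
    using fin by (simp add: card_Diff_singleton card_Pow of_nat_diff)
  moreover have "Re (sieve_term b {}) \<ge> real q ^ (n - 1) - B"
    using Re_square_trace_sum_0_ge[OF b] by (simp add: sieve_term_def square_trace_sum_def B_def)
  moreover have "B \<ge> 0"
    by (simp add: B_def)
  moreover have "(\<Sum>D\<in>Pow P. sieve_term b D) = sieve_term b {} + (\<Sum>D\<in>Pow P - {{}}. sieve_term b D)"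
    using fin by (subst sum.remove[of "Pow P" "{}"]) auto
  \<comment> \<open>The loss \<open>B\<close> in the main term is enlarged to \<open>2 * B\<close>,
    so that all \<open>2 ^ card P\<close> subsets are charged alike.\<close>
  ultimately have "Re (\<Sum>D\<in>Pow P. sieve_term b D) \<ge> real q ^ (n - 1) - 2 ^ card P * (2 * B)"
    by (simp add: algebra_simps)
  moreover have "real (nonresidue_count b P) = density P * Re (\<Sum>D\<in>Pow P. sieve_term b D)"
    using arg_cong[OF nonresidue_count_expansion[OF P], of Re] by simp
  ultimately show ?thesis
    unfolding B_def using density_nonneg[OF P] by (simp add: mult_left_mono)
qed

text \<open>The difference cancels all subsets avoiding \<open>l\<close>, including the main term;
  only the \<open>2 ^ card P\<close> subsets containing \<open>l\<close> remain.\<close>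

lemma nonresidue_count_insert_ge:
  assumes P: "prime_divisors (insert l P)" "l \<notin> P" and b: "b \<in> K" "b \<noteq> 0"
  shows "real (nonresidue_count b (insert l P)) - (1 - 1 / real l) * real (nonresidue_count b P) \<ge>
    - ((1 - 1 / real l) * (density P * (2 ^ card P * (2 * sqrt (real q ^ (n - 1))))))"
proof -
  define B where "B = sqrt (real q ^ (n - 1))"
  have fin: "finite P" and P': "prime_divisors P"
    using P by (auto simp: prime_divisors_def)
  have density: "density (insert l P) = (1 - 1 / real l) * density P"
    using fin P by (simp add: density_def)
  have inj: "inj_on (insert l) (Pow P)"
    using P(2) by (intro inj_onI) (metis Pow_iff insert_ident subsetD)
  have "(\<Sum>D\<in>Pow (insert l P). sieve_term b D) = (\<Sum>D\<in>Pow P. sieve_term b D) + (\<Sum>D\<in>Pow P. sieve_term b (insert l D))"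
    unfolding Pow_insert using fin P
    by (subst sum.union_disjoint) (auto simp: sum.reindex[OF inj])
  hence "real (nonresidue_count b (insert l P)) - (1 - 1 / real l) * real (nonresidue_count b P) =
      density (insert l P) * Re (\<Sum>D\<in>Pow P. sieve_term b (insert l D))"
    using arg_cong[OF nonresidue_count_expansion[OF P(1)], of Re b] arg_cong[OF nonresidue_count_expansion[OF P'], of Re b]
    by (simp add: density algebra_simps)
  moreover have "Re (\<Sum>D\<in>Pow P. sieve_term b (insert l D)) \<ge> - (2 ^ card P * (2 * B))"
  proof -
    have "norm (\<Sum>D\<in>Pow P. sieve_term b (insert l D)) \<le> (\<Sum>D\<in>Pow P. 2 * B)"
      unfolding B_def using P b fin
      by (intro sum_norm_le norm_sieve_term_le) (auto simp: prime_divisors_def intro: finite_subset)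
    also have "\<dots> = 2 ^ card P * (2 * B)"
      using fin by (simp add: card_Pow)
    finally show ?thesis
      using abs_Re_le_cmod[of "\<Sum>D\<in>Pow P. sieve_term b (insert l D)"] by linarith
  qed
  hence "density (insert l P) * Re (\<Sum>D\<in>Pow P. sieve_term b (insert l D)) \<ge>
      density (insert l P) * - (2 ^ card P * (2 * B))"
    by (rule mult_left_mono) (rule density_nonneg[OF P(1)])
  ultimately show ?thesis
    unfolding B_def density by (simp add: mult.assoc)
qed

text \<open>Pointwise, the number of conditions from \<open>S\<close> that hold, minus
  \<open>card S - 1\<close>, is 1 if all hold and at most 0 otherwise.\<close>

lemma nonresidue_count_union_ge:
  assumes "finite S"
  shows "real (nonresidue_count b (P \<union> S)) \<ge> (\<Sum>l\<in>S. real (nonresidue_count b (insert l P))) - (real (card S) - 1) * real (nonresidue_count b P)"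
proof -
  define X where "X = {x. x \<noteq> 0 \<and> Tr q n (x\<^sup>2) = b \<and> (\<forall>l\<in>P. \<chi> x ^ (N div l) \<noteq> 1)}"
  have eq: "real (nonresidue_count b (P \<union> S)) = (\<Sum>x\<in>X. of_bool (\<forall>l\<in>S. \<chi> x ^ (N div l) \<noteq> 1))" for S
    by (simp add: nonresidue_count_def X_def Int_def conj_ac ball_Un)
  have eq1: "real (nonresidue_count b (insert l P)) = (\<Sum>x\<in>X. of_bool (\<chi> x ^ (N div l) \<noteq> 1))" for l
    using eq[of "{l}"] by simp
  have eq0: "real (nonresidue_count b P) = real (card X)"
    using eq[of "{}"] by simp
  have "(\<Sum>l\<in>S. real (nonresidue_count b (insert l P))) - (real (card S) - 1) * real (nonresidue_count b P) =
      (\<Sum>x\<in>X. (\<Sum>l\<in>S. of_bool (\<chi> x ^ (N div l) \<noteq> 1)) - (real (card S) - 1))"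
    unfolding eq1 eq0 sum_subtractf by (subst sum.swap) (simp add: algebra_simps)
  also have "\<dots> \<le> (\<Sum>x\<in>X. of_bool (\<forall>l\<in>S. \<chi> x ^ (N div l) \<noteq> 1))"
  proof (rule sum_mono)
    fix x
    show "(\<Sum>l\<in>S. of_bool (\<chi> x ^ (N div l) \<noteq> 1)) - (real (card S) - 1) \<le>
        of_bool (\<forall>l\<in>S. \<chi> x ^ (N div l) \<noteq> 1)"
    proof (cases "\<forall>l\<in>S. \<chi> x ^ (N div l) \<noteq> 1")
      case False
      hence "card (S \<inter> {l. \<chi> x ^ (N div l) \<noteq> 1}) < card S"
        using assms by (intro psubset_card_mono) auto
      thus ?thesis
        using assms False by simp
    qed simp
  qed
  finally show ?thesis
    by (simp only: eq)
qed

text \<open>Since the \<open>1 - 1 / l\<close> sum to \<open>card S - 1 + \<delta>\<close>, the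
  sieve inequality regroups into differences without main term plus \<open>\<delta>\<close> times
  the count for \<open>P\<close>. The errors, \<open>card S - 1 + \<delta>\<close> and
  \<open>\<delta>\<close>, add up to \<open>card S - 1 + 2 * \<delta>\<close>.\<close>

lemma sieve_bound:
  assumes P: "prime_divisors (P \<union> S)" "P \<inter> S = {}" and b: "b \<in> K" "b \<noteq> 0"
    and \<delta>: "\<delta> = 1 - (\<Sum>l\<in>S. 1 / real l)" "\<delta> \<ge> 0"
  shows "real (nonresidue_count b (P \<union> S)) \<ge> density P * (\<delta> * real q ^ (n - 1) -
    (real (card S) - 1 + 2 * \<delta>) * (2 ^ card P * (2 * sqrt (real q ^ (n - 1)))))"
proof -
  define R where "R = 2 ^ card P * (2 * sqrt (real q ^ (n - 1)))"
  have fin: "finite S" and P': "prime_divisors P"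
    using P by (auto simp: prime_divisors_def)
  have sum: "(\<Sum>l\<in>S. 1 - 1 / real l) = real (card S) - 1 + \<delta>"
    by (simp add: \<delta> sum_subtractf)
  have "- (real (card S) - 1 + \<delta>) * (density P * R) = (\<Sum>l\<in>S. - ((1 - 1 / real l) * (density P * R)))"
    unfolding sum[symmetric] by (simp only: sum_distrib_right sum_negf mult_minus_left)
  also have "\<dots> \<le> (\<Sum>l\<in>S. real (nonresidue_count b (insert l P)) - (1 - 1 / real l) * real (nonresidue_count b P))"
    unfolding R_def using P b
    by (intro sum_mono nonresidue_count_insert_ge) (auto simp: prime_divisors_def)
  also have "\<dots> = (\<Sum>l\<in>S. real (nonresidue_count b (insert l P))) - (real (card S) - 1 + \<delta>) * real (nonresidue_count b P)"
    unfolding sum[symmetric] by (simp only: sum_subtractf[of "\<lambda>l. real (nonresidue_count b (insert l P))"] sum_distrib_right)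
  finally have "- (real (card S) - 1 + \<delta>) * (density P * R) + \<delta> * real (nonresidue_count b P) \<le> real (nonresidue_count b (P \<union> S))"
    using nonresidue_count_union_ge[OF fin, of b P] by (simp add: algebra_simps)
  moreover have "\<delta> * real (nonresidue_count b P) \<ge> \<delta> * (density P * (real q ^ (n - 1) - R))"
    unfolding R_def by (intro mult_left_mono nonresidue_count_ge P' b \<delta>)
  ultimately show ?thesis
    unfolding R_def[symmetric] by (simp add: algebra_simps)
qed

text \<open>If \<open>x = y ^ d\<close> with \<open>d \<noteq> 1\<close> dividing \<open>N\<close>,
  any prime \<open>l\<close> dividing \<open>d\<close> makes \<open>x\<close> an \<open>l\<close>-th
  power.\<close>

lemma nonresidue_count_le_N_free: "nonresidue_count b (prime_factors N) \<le> N_free q n b N"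
  unfolding nonresidue_count_def N_free_def
proof (rule card_mono)
  show "{x. x \<noteq> 0 \<and> Tr q n (x\<^sup>2) = b \<and> (\<forall>l\<in>prime_factors N. \<chi> x ^ (N div l) \<noteq> 1)} \<subseteq>
      {x. m_free N x \<and> Tr q n (x\<^sup>2) = b}"
  proof safe
    fix x :: 'a
    assume x: "x \<noteq> 0" "\<forall>l\<in>prime_factors N. \<chi> x ^ (N div l) \<noteq> 1"
    show "m_free N x"
      unfolding m_free_def
    proof (intro conjI allI impI x(1))
      fix d and y :: 'a
      assume d: "d dvd N" "y \<noteq> 0" "x = y ^ d"
      show "d = 1"
      proof (rule ccontr)
        assume "d \<noteq> 1"
        then obtain l where l: "prime l" "l dvd d"
          using prime_factor_nat by blast
        then obtain m where m: "d = l * m"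
          by blast
        have "l dvd N"
          using l d dvd_trans by blast
        have "\<chi> x ^ (N div l) = (\<chi> y ^ (l * (N div l))) ^ m"
          by (simp add: d m \<chi>_power mult_ac flip: power_mult)
        also have "\<dots> = 1"
          using \<open>l dvd N\<close> \<chi>_power_N[OF d(2)] by simp
        finally show False
          using x(2) l \<open>l dvd N\<close> N_gt_1 by (auto simp: prime_factors_dvd)
      qed
    qed
  qed
qed auto

end

section \<open>Radicals and square-free divisors\<close>

lemma prod_prime_factors_dvd:
  fixes k :: nat
  assumes "k > 0"
  shows "\<Prod>(prime_factors k) dvd k"
proof -
  have "\<Prod>(prime_factors k) dvd (\<Prod>l\<in>prime_factors k. l ^ multiplicity l k)"
    by (intro prod_dvd_prod dvd_power) (auto simp: prime_factors_multiplicity)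
  thus ?thesis
    using assms prod_prime_factors[of k] by simp
qed

lemma prime_factors_prod_primes:
  fixes p :: "'i \<Rightarrow> nat"
  assumes "finite A" "\<And>i. i \<in> A \<Longrightarrow> prime (p i)"
  shows "prime_factors (\<Prod>i\<in>A. p i) = p ` A"
proof -
  have "0 \<notin> p ` A"
    using assms(2) by fastforce
  hence "prime_factors (\<Prod>i\<in>A. p i) = (\<Union>i\<in>A. prime_factors (p i))"
    using assms(1) by (simp add: prime_factors_prod)
  also have "\<dots> = p ` A"
    using assms(2) by (auto simp: prime_prime_factors)
  finally show ?thesis .
qed

lemma squarefree_prod_prime_factors: "squarefree (\<Prod>(prime_factors m))" for m :: nat
  by (rule squarefree_prod_coprime) (auto intro!: primes_coprime squarefree_prime)

text \<open>Each set of prime factors is recovered from its product, so distinct sets give distinct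
  square-free divisors.\<close>

lemma W_ge_2_power:
  assumes "squarefree k"
  shows "W k \<ge> 2 ^ card (prime_factors k)"
proof -
  define P where "P = prime_factors k"
  have k: "k > 0"
    using assms not_squarefree_0 by (cases k) auto
  have fin: "finite P" and P: "\<And>l. l \<in> P \<Longrightarrow> prime l"
    by (auto simp: P_def)
  have inj: "inj_on Prod (Pow P)"
  proof (rule inj_onI)
    have "prime_factors (\<Prod>D) = D" if "D \<in> Pow P" for D
      using prime_factors_prod_primes[of D "\<lambda>x. x"] P that finite_subset[OF _ fin] by auto
    thus "D = D'" if "D \<in> Pow P" "D' \<in> Pow P" "\<Prod>D = \<Prod>D'" for D D'
      using that by metis
  qed
  have "\<Prod>D dvd k" if "D \<subseteq> P" for D
  proof -
    have "\<Prod>D dvd \<Prod>P"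
      using that fin by (intro prod_dvd_prod_subset)
    also have "\<dots> dvd k"
      unfolding P_def using k by (rule prod_prime_factors_dvd)
    finally show ?thesis .
  qed
  hence "Prod ` Pow P \<subseteq> {d. d dvd k \<and> squarefree d}"
    using squarefree_mono[OF _ assms] by auto
  hence "card (Pow P) \<le> W k"
    unfolding W_def using k by (intro card_inj_on_le[OF inj]) auto
  thus ?thesis
    using fin by (simp add: card_Pow P_def)
qed

lemma W_mono: "d dvd k \<Longrightarrow> k > 0 \<Longrightarrow> W d \<le> W k"
  unfolding W_def by (intro card_mono) (auto intro: dvd_trans)


section \<open>Passage from the sieve bound to the stated inequality\<close>

theorem theorem5p10:
  fixes q n k r s Q k_Q :: nat
    and p :: "nat \<Rightarrow> nat"
    and F\<^sub>q :: "'a::{field,finite} set"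
    and \<beta> :: 'a
    and \<delta> \<delta>_Q :: real
  assumes q: "primepow q" "odd q"
    and n: "n \<ge> 2"
    and field: "CARD('a) = q ^ n" "is_subfield F\<^sub>q" "card F\<^sub>q = q"
    and even: "even ((q ^ n - 1) div 2)"
    and \<beta>: "\<beta> \<in> F\<^sub>q" "\<beta> \<noteq> 0"
    and Q: "Q = (q ^ n - 1) div (q - 1)"
    and rad: "\<Prod>(prime_factors (q ^ n - 1)) = k * (\<Prod>i=1..s. p i)"
    and p: "\<And>i. i \<in> {1..s} \<Longrightarrow> prime (p i)"
           "\<And>i. i \<in> {1..s} \<Longrightarrow> \<not> p i dvd k"
           "inj_on p {1..s}"
    and r: "r \<le> s"
           "\<And>i. i \<in> {1..r} \<Longrightarrow> p i dvd Q"
           "\<And>i. i \<in> {r<..s} \<Longrightarrow> \<not> p i dvd Q"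
    and \<delta>: "\<delta> = 1 - (\<Sum>i=1..s. 1 / real (p i))"
    and \<delta>_Q: "\<delta>_Q = 1 - (\<Sum>i=1..r. 1 / real (p i))"
    and k_Q: "k_Q = \<Prod>{l \<in> prime_factors k. l dvd Q}"
    and \<delta>_pos: "\<delta> > 0"
  shows "real (N_free q n \<beta> (q ^ n - 1)) \<ge>
           \<delta> * \<theta> k * real q powr ((real n - 1) / 2) *
             (real q powr ((real n - 1) / 2)
              - 4 * ((real s - 1) / \<delta> + 2) * real (W k)
              + 2 * ((real r - 1 + \<delta>_Q) / \<delta> + 1) * real (W k_Q))
         \<and> (real q powr ((real n - 1) / 2) >
              4 * ((real s - 1) / \<delta> + 2) * real (W k)
              - 2 * ((real r - 1 + \<delta>_Q) / \<delta> + 1) * real (W k_Q)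
            \<longrightarrow> N_free q n \<beta> (q ^ n - 1) > 0)"
proof -
  define N where "N = q ^ n - 1"
  define S where "S = p ` {1..s}"
  define P where "P = prime_factors k"
  define a where "a = real q powr ((real n - 1) / 2)"
  obtain \<chi> :: "'a \<Rightarrow> complex"
    where \<chi>: "inj \<chi> \<and> \<chi> 0 = 0 \<and> (\<forall>x y. \<chi> (x * y) = \<chi> x * \<chi> y)"
    using ex_injective_character by (rule exE)
  interpret F: finite_field_character q n F\<^sub>q \<chi>
    by unfold_locales (use q n field \<chi> in auto)
  have N: "F.N = N"
    by (simp add: F.N_def N_def)

  have k: "squarefree k"
    using squarefree_prod_prime_factors[of "q ^ n - 1"] unfolding rad by (rule squarefree_multD)
  hence k0: "k > 0"
    using not_squarefree_0 by (cases k) auto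
  have "prime_factors (\<Prod>(prime_factors N)) = prime_factors N"
    using prime_factors_prod_primes[of "prime_factors N" "\<lambda>x. x"] by auto
  moreover have "prime_factors (k * (\<Prod>i=1..s. p i)) = P \<union> S"
    using k0 p(1) prime_factors_prod_primes[of "{1..s}" p]
    by (subst prime_factors_product) (auto simp: P_def S_def intro!: prime_gt_0_nat)
  ultimately have PS: "prime_factors N = P \<union> S"
    using rad by (simp add: N_def)
  have disj: "P \<inter> S = {}"
    using p(2) by (auto simp: P_def S_def)
  have "F.prime_divisors (prime_factors N)"
    by (auto simp: F.prime_divisors_def N)
  hence PS': "F.prime_divisors (P \<union> S)"
    by (simp only: PS)

  have card_S: "card S = s"
    using p(3) by (simp add: S_def card_image)
  have \<delta>': "\<delta> = 1 - (\<Sum>l\<in>S. 1 / real l)"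
    using p(3) by (simp add: \<delta> S_def sum.reindex)
  have \<theta>: "\<theta> k = F.density P"
    using k0 by (simp add: \<theta>_def totient_formula2 F.density_def P_def)
  have \<theta>_pos: "\<theta> k > 0"
    using k0 by (simp add: \<theta>_def)
  have a: "a > 0" "sqrt (real q ^ (n - 1)) = a" "real q ^ (n - 1) = a * a"
  proof -
    have q0: "real q > 0"
      using F.q_gt_1 by simp
    show "a > 0"
      using q0 by (simp add: a_def)
    have "a * a = real q powr (real (n - 1))"
      unfolding a_def powr_add[symmetric] using n by (simp add: of_nat_diff)
    thus aa: "real q ^ (n - 1) = a * a"
      using q0 by (simp add: powr_realpow)
    show "sqrt (real q ^ (n - 1)) = a"
      unfolding aa using \<open>a > 0\<close> by simp
  qed

  \<comment> \<open>Both sides are sums of the nonnegative numbers \<open>1 - 1 / p i\<close>, the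
    left one over fewer indices.\<close>
  have sum_le: "real r - 1 + \<delta>_Q \<le> real s - 1 + \<delta>" and sum_nonneg: "0 \<le> real s - 1 + \<delta>"
  proof -
    have "real r - 1 + \<delta>_Q = (\<Sum>i=1..r. 1 - 1 / real (p i))"
      "real s - 1 + \<delta> = (\<Sum>i=1..s. 1 - 1 / real (p i))"
      by (simp_all add: \<delta> \<delta>_Q sum_subtractf)
    moreover have "0 \<le> 1 - 1 / real (p i)" if "i \<in> {1..s}" for i
      using prime_gt_1_nat[OF p(1)[OF that]] by simp
    moreover have "(\<Sum>i=1..r. 1 - 1 / real (p i)) \<le> (\<Sum>i=1..s. 1 - 1 / real (p i))"
      using r(1) calculation(3) by (intro sum_mono2) auto
    ultimately show "real r - 1 + \<delta>_Q \<le> real s - 1 + \<delta>" "0 \<le> real s - 1 + \<delta>"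
      by (auto intro: sum_nonneg)
  qed
  have W: "real (2 ^ card P) \<le> real (W k)"
    unfolding P_def of_nat_le_iff by (rule W_ge_2_power[OF k])
  have "k_Q dvd \<Prod>(prime_factors k)"
    unfolding k_Q by (intro prod_dvd_prod_subset) auto
  hence "k_Q dvd k"
    using prod_prime_factors_dvd[OF k0] dvd_trans by blast
  hence W_Q: "real (W k_Q) \<le> real (W k)"
    using W_mono k0 by simp

  have "(real r - 1 + \<delta>_Q + \<delta>) * real (W k_Q) \<le> (real s - 1 + 2 * \<delta>) * real (W k_Q)"
    using sum_le by (intro mult_right_mono) auto
  also have "\<dots> \<le> (real s - 1 + 2 * \<delta>) * real (W k)"
    using W_Q sum_nonneg \<delta>_pos by (intro mult_left_mono) auto
  finally have 1: "(real r - 1 + \<delta>_Q + \<delta>) * real (W k_Q) \<le> (real s - 1 + 2 * \<delta>) * real (W k)" .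
  have 2: "(real s - 1 + 2 * \<delta>) * 2 ^ card P \<le> (real s - 1 + 2 * \<delta>) * real (W k)"
    using W sum_nonneg \<delta>_pos by (intro mult_left_mono) auto

  have "\<delta> * \<theta> k * a * (a - 4 * ((real s - 1) / \<delta> + 2) * real (W k)
      + 2 * ((real r - 1 + \<delta>_Q) / \<delta> + 1) * real (W k_Q)) =
      \<theta> k * a * (\<delta> * a - 4 * ((real s - 1 + 2 * \<delta>) * real (W k))
      + 2 * ((real r - 1 + \<delta>_Q + \<delta>) * real (W k_Q)))"
    using \<delta>_pos by (simp add: field_simps)
  \<comment> \<open>With X = \<open>(real s - 1 + 2 * \<delta>) * real (W k)\<close>, the positive
    term is at most 2X by \<open>1\<close>. So -4X plus that term is at most -2X, and
    \<open>2\<close> replaces \<open>W k\<close> by \<open>2 ^ card P\<close>.\<close>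
  also have "\<dots> \<le> \<theta> k * a * (\<delta> * a - 2 * ((real s - 1 + 2 * \<delta>) * 2 ^ card P))"
    using 1 2 \<theta>_pos a(1) by (intro mult_left_mono) auto
  also have "\<dots> = \<theta> k * (\<delta> * (a * a) - (real s - 1 + 2 * \<delta>) * (2 ^ card P * (2 * a)))"
    by (simp add: algebra_simps)
  also have "\<dots> \<le> real (F.nonresidue_count \<beta> (P \<union> S))"
    using F.sieve_bound[OF PS' disj \<beta> \<delta>'] \<delta>_pos a(1) unfolding a card_S \<theta> by simp
  also have "\<dots> \<le> real (N_free q n \<beta> (q ^ n - 1))"
    using F.nonresidue_count_le_N_free[of \<beta>, unfolded N PS, unfolded N_def] by simp
  finally have bound: "\<delta> * \<theta> k * a * (a - 4 * ((real s - 1) / \<delta> + 2) * real (W k)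
      + 2 * ((real r - 1 + \<delta>_Q) / \<delta> + 1) * real (W k_Q)) \<le> real (N_free q n \<beta> (q ^ n - 1))" .
  moreover have "N_free q n \<beta> (q ^ n - 1) > 0"
    if "a > 4 * ((real s - 1) / \<delta> + 2) * real (W k)
      - 2 * ((real r - 1 + \<delta>_Q) / \<delta> + 1) * real (W k_Q)"
  proof -
    have "0 < \<delta> * \<theta> k * a * (a - 4 * ((real s - 1) / \<delta> + 2) * real (W k)
        + 2 * ((real r - 1 + \<delta>_Q) / \<delta> + 1) * real (W k_Q))"
      using that \<delta>_pos \<theta>_pos a(1) by (intro mult_pos_pos) auto
    thus ?thesis
      using bound by simp
  qed
  ultimately show ?thesis
    unfolding a_def[symmetric] by blast
qed

end
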